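(* Let $(X,d)$ be a symmetric space, let $\Gamma$ be a discrete group of isometries of $X$, and let $D$ be a fundamental domain for the action of $\Gamma$ on $X$. Suppose $D$ has compact closure. Then the geometric distance function $d_R$ on $\Gamma$ (defined using any point $p_0\in X$ with trivial stabiliser in $\Gamma$) is Lipschitz equivalent to the word distance function $d_W$ on $\Gamma$ (defined using any finite generating set of $\Gamma$).
   Context: A symmetric space $(X,d)$ is a differentiable manifold $X$ which is a metric space with a Riemannian distance function $d$ (the distance function of a Riemannian metric), such that some group $G$ acts transitively and by isometries on $X$, and there are a point $0\in X$ and an element $k\in G$ with $k\cdot 0=0$ and differential $Dk(0)=-I$. A discrete group of isometries of $X$ is a subgroup of the isometry group of $X$ that is discrete in the compact-open topology. A fundamental domain for $\Gamma$ is a connected open subset $D\subseteq X$ such that the sets $\gamma D$ ($\gamma\in\Gamma$) are mutually disjoint and $X=\bigcup_{\gamma\in\Gamma}\gamma\overline{D}$. Geometric distance function: for $p_0\in X$ whose stabiliser in $\Gamma$ is trivial, $d_R(\gamma_1,\gamma_2)=d(\gamma_1p_0,\gamma_2p_0)$. Word distance function: for a finite generating set $\Sigma$ of $\Gamma$, $d_W(\gamma_1,\gamma_2)$ is the smallest integer $n\ge0$ such that $\gamma_1^{-1}\gamma_2$ is a product of $n$ elements of $\Sigma\cup\Sigma^{-1}$. In this setting $\Gamma$ is finitely generated. Two distance functions $\delta,\delta'$ on $\Gamma$ are Lipschitz equivalent if there are constants $c,C>0$ such that $c\,\delta(\gamma_1,\gamma_2)\le\delta'(\gamma_1,\gamma_2)\le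 C\,\delta(\gamma_1,\gamma_2)$ for all $\gamma_1,\gamma_2\in\Gamma$. *)

theory Defs
  imports
    "HOL-Algebra.Group_Action"
    "HOL-Algebra.Generated_Groups"
    "HOL-Analysis.Analysis"
begin

text \<open>
  The model space is a linear subspace V of a Euclidean space, so that the dimension
  dim V is an arbitrary natural number, including 0. On a set S that is relatively
  open in V the derivative within S is unique along V, and only its values on V are used.
\<close>

fun Ck_on :: "'e::euclidean_space set \<Rightarrow> nat \<Rightarrow> ('e \<Rightarrow> 'f::real_normed_vector) \<Rightarrow> 'e set \<Rightarrow> bool" where
  "Ck_on V 0 f S \<longleftrightarrow> continuous_on S f"
| "Ck_on V (Suc k) f S \<longleftrightarrow>
     (\<exists>f'. (\<forall>x\<in>S. (f has_derivative f' x) (at x within S)) \<and>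
           (\<forall>v\<in>V. Ck_on V k (\<lambda>x. f' x v) S))"

definition smooth_on :: "'e::euclidean_space set \<Rightarrow> ('e \<Rightarrow> 'f::real_normed_vector) \<Rightarrow> 'e set \<Rightarrow> bool" where
  "smooth_on V f S \<longleftrightarrow> (\<forall>k. Ck_on V k f S)"

text \<open>
  A chart is a pair of its domain and the coordinate map; values of the coordinate map
  outside the domain are irrelevant.
\<close>

type_synonym ('x, 'e) chart = "'x set \<times> ('x \<Rightarrow> 'e)"

locale smooth_manifold =
  fixes V :: "'e::euclidean_space set"
    and A :: "('x::topological_space, 'e) chart set"
  assumes subspace_model: "subspace V"
    and charts_cover: "(\<Union>(U, \<phi>)\<in>A. U) = UNIV"
    and chart_domain: "(U, \<phi>) \<in> A \<Longrightarrow> open U"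
    and chart_image: "(U, \<phi>) \<in> A \<Longrightarrow> openin (top_of_set V) (\<phi> ` U)"
    and chart_homeomorphism: "(U, \<phi>) \<in> A \<Longrightarrow> homeomorphism U (\<phi> ` U) \<phi> (inv_into U \<phi>)"
    and transition_smooth:
      "\<lbrakk>(U, \<phi>) \<in> A; (W, \<psi>) \<in> A\<rbrakk> \<Longrightarrow> smooth_on V (\<psi> \<circ> inv_into U \<phi>) (\<phi> ` (U \<inter> W))"

definition inner_product_on :: "'e::real_vector set \<Rightarrow> ('e \<Rightarrow> 'e \<Rightarrow> real) \<Rightarrow> bool" where
  "inner_product_on V b \<longleftrightarrow>
     (\<forall>u\<in>V. \<forall>v\<in>V. b u v = b v u) \<and>
     (\<forall>u\<in>V. \<forall>v\<in>V. \<forall>w\<in>V. b (u + v) w = b u w + b v w) \<and>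
     (\<forall>r. \<forall>u\<in>V. \<forall>v\<in>V. b (r *\<^sub>R u) v = r * b u v) \<and>
     (\<forall>u\<in>V. u \<noteq> 0 \<longrightarrow> b u u > 0)"

text \<open>
  The tensor is given by its coordinate expressions: g (U, phi) p is the bilinear form
  on the model space that represents the inner product on the tangent space at p in the
  chart (U, phi). The expressions in two charts are related by the derivative T of the
  transition map.
\<close>

locale riemannian_manifold = smooth_manifold V A
  for V :: "'e::euclidean_space set"
    and A :: "('x::topological_space, 'e) chart set" +
  fixes g :: "('x, 'e) chart \<Rightarrow> 'x \<Rightarrow> 'e \<Rightarrow> 'e \<Rightarrow> real"
  assumes metric_inner_product:
      "\<lbrakk>(U, \<phi>) \<in> A; p \<in> U\<rbrakk> \<Longrightarrow> inner_product_on V (g (U, \<phi>) p)"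
    and metric_smooth:
      "\<lbrakk>(U, \<phi>) \<in> A; u \<in> V; v \<in> V\<rbrakk> \<Longrightarrow>
         smooth_on V (\<lambda>y. g (U, \<phi>) (inv_into U \<phi> y) u v) (\<phi> ` U)"
    and metric_transform:
      "\<lbrakk>(U, \<phi>) \<in> A; (W, \<psi>) \<in> A; p \<in> U \<inter> W;
        (\<psi> \<circ> inv_into U \<phi> has_derivative T) (at (\<phi> p) within \<phi> ` (U \<inter> W));
        u \<in> V; v \<in> V\<rbrakk> \<Longrightarrow>
         g (U, \<phi>) p u v = g (W, \<psi>) p (T u) (T v)"

definition C1_curve_on ::
    "('x::topological_space, 'e::euclidean_space) chart set \<Rightarrow> (real \<Rightarrow> 'x) \<Rightarrow> real set \<Rightarrow> bool" where
  "C1_curve_on A c I \<longleftrightarrow>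
     continuous_on I c \<and>
     (\<forall>(U, \<phi>)\<in>A. \<exists>v. continuous_on (I \<inter> c -` U) v \<and>
        (\<forall>t\<in>I \<inter> c -` U. (\<phi> \<circ> c has_vector_derivative v t) (at t within I)))"

text \<open>The finite set P below is the partition; it has to contain both end points.\<close>

definition piecewise_C1_curve ::
    "('x::topological_space, 'e::euclidean_space) chart set \<Rightarrow> (real \<Rightarrow> 'x) \<Rightarrow> real \<Rightarrow> real \<Rightarrow> bool" where
  "piecewise_C1_curve A c a b \<longleftrightarrow>
     a \<le> b \<and> continuous_on {a..b} c \<and>
     (\<exists>P. finite P \<and> {a, b} \<subseteq> P \<and> P \<subseteq> {a..b} \<and>
        (\<forall>s\<in>P. \<forall>t\<in>P. s < t \<and> {s<..<t} \<inter> P = {} \<longrightarrow> C1_curve_on A c {s..t}))"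

text \<open>
  By the transformation rule the speed does not depend on the chart that is chosen.
  It is meaningful where the curve is differentiable, that is, for a piecewise C1 curve,
  at all but finitely many parameters; these do not affect the integral.
\<close>

definition speed ::
    "('x, 'e::euclidean_space) chart set \<Rightarrow> (('x, 'e) chart \<Rightarrow> 'x \<Rightarrow> 'e \<Rightarrow> 'e \<Rightarrow> real) \<Rightarrow>
     (real \<Rightarrow> 'x) \<Rightarrow> real \<Rightarrow> real" where
  "speed A g c t =
     (let \<kappa> = (SOME \<kappa>. \<kappa> \<in> A \<and> c t \<in> fst \<kappa>);
          v = vector_derivative (snd \<kappa> \<circ> c) (at t)
      in sqrt (g \<kappa> (c t) v v))"

definition curve_lengths ::
    "('x::topological_space, 'e::euclidean_space) chart set \<Rightarrow>
     (('x, 'e) chart \<Rightarrow> 'x \<Rightarrow> 'e \<Rightarrow> 'e \<Rightarrow> real) \<Rightarrow> 'x \<Rightarrow> 'x \<Rightarrow> real set" where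
  "curve_lengths A g x y =
     {L. \<exists>c a b. piecewise_C1_curve A c a b \<and> c a = x \<and> c b = y \<and>
                 (speed A g c has_integral L) {a..b}}"

text \<open>
  The infimum is taken in the extended reals, where the infimum of the empty set is
  infinite: any two points are therefore joined by a curve, that is, the manifold is
  connected. The charts are homeomorphisms for the topology of the distance function.
\<close>

locale riemannian_metric_space = riemannian_manifold V A g
  for V :: "'e::euclidean_space set"
    and A :: "('x::metric_space, 'e) chart set"
    and g :: "('x, 'e) chart \<Rightarrow> 'x \<Rightarrow> 'e \<Rightarrow> 'e \<Rightarrow> real" +
  assumes riemannian_distance: "ereal (dist x y) = (INF L\<in>curve_lengths A g x y. ereal L)"

text \<open>
  In symmetry, the coordinate expression of the isometry is only relevant near phi p,
  where it stays in the domain of the chart.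
\<close>

locale symmetric_space =
  riemannian_metric_space V A g + transitive_action G "UNIV :: 'x set" act
  for V :: "'e::euclidean_space set"
    and A :: "('x::metric_space, 'e) chart set"
    and g :: "('x, 'e) chart \<Rightarrow> 'x \<Rightarrow> 'e \<Rightarrow> 'e \<Rightarrow> real"
    and G :: "('g, 'm) monoid_scheme"
    and act :: "'g \<Rightarrow> 'x \<Rightarrow> 'x" +
  assumes acts_by_isometries: "h \<in> carrier G \<Longrightarrow> dist (act h x) (act h y) = dist x y"
    and symmetry:
      "\<exists>p. \<exists>k\<in>carrier G. act k p = p \<and>
         (\<forall>(U, \<phi>)\<in>A. p \<in> U \<longrightarrow>
            (\<phi> \<circ> act k \<circ> inv_into U \<phi> has_derivative (\<lambda>v. - v)) (at (\<phi> p) within \<phi> ` U))"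

definition isometry_group :: "('x::metric_space \<Rightarrow> 'x) monoid" where
  "isometry_group =
     \<lparr>carrier = {f. bij f \<and> (\<forall>x y. dist (f x) (f y) = dist x y)}, monoid.mult = (\<circ>), one = id\<rparr>"

definition compact_open_topology :: "('a::topological_space \<Rightarrow> 'b::topological_space) topology" where
  "compact_open_topology =
     topology_generated_by {{f. continuous_on UNIV f \<and> f ` K \<subseteq> U} | K U. compact K \<and> open U}"

definition discrete_isometry_group :: "('x::metric_space \<Rightarrow> 'x) set \<Rightarrow> bool" where
  "discrete_isometry_group \<Gamma> \<longleftrightarrow>
     subgroup \<Gamma> isometry_group \<and>
     subtopology compact_open_topology \<Gamma> = discrete_topology \<Gamma>"

definition fundamental_domain :: "('x::metric_space \<Rightarrow> 'x) set \<Rightarrow> 'x set \<Rightarrow> bool" where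
  "fundamental_domain \<Gamma> D \<longleftrightarrow>
     connected D \<and> open D \<and>
     disjoint_family_on (\<lambda>\<gamma>. \<gamma> ` D) \<Gamma> \<and>
     (\<Union>\<gamma>\<in>\<Gamma>. \<gamma> ` closure D) = UNIV"

definition geometric_dist :: "'x::metric_space \<Rightarrow> ('x \<Rightarrow> 'x) \<Rightarrow> ('x \<Rightarrow> 'x) \<Rightarrow> real" where
  "geometric_dist p \<gamma>\<^sub>1 \<gamma>\<^sub>2 = dist (\<gamma>\<^sub>1 p) (\<gamma>\<^sub>2 p)"

definition word_dist :: "('g, 'm) monoid_scheme \<Rightarrow> 'g set \<Rightarrow> 'g \<Rightarrow> 'g \<Rightarrow> nat" where
  "word_dist G S a b =
     (LEAST n. \<exists>ws. length ws = n \<and> set ws \<subseteq> S \<union> (\<lambda>s. inv\<^bsub>G\<^esub> s) ` S \<and>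
                    inv\<^bsub>G\<^esub> a \<otimes>\<^bsub>G\<^esub> b = foldr (\<lambda>s t. s \<otimes>\<^bsub>G\<^esub> t) ws \<one>\<^bsub>G\<^esub>)"

definition lipschitz_equivalent_on ::
    "'g set \<Rightarrow> ('g \<Rightarrow> 'g \<Rightarrow> real) \<Rightarrow> ('g \<Rightarrow> 'g \<Rightarrow> real) \<Rightarrow> bool" where
  "lipschitz_equivalent_on \<Gamma> \<delta> \<delta>' \<longleftrightarrow>
     (\<exists>c>0. \<exists>C>0. \<forall>a\<in>\<Gamma>. \<forall>b\<in>\<Gamma>. c * \<delta> a b \<le> \<delta>' a b \<and> \<delta>' a b \<le> C * \<delta> a b)"

end

theory Submission
  imports Defs
begin

text \<open>
  The proof is the Milnor--Schwarz argument. Cutting almost minimal curves shows that X is a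
  length space; since X is locally compact and homogeneous, closed balls are compact. The tiles
  are disjoint and each contains a ball of a fixed radius, hence only finitely many elements of
  the group move a point by a bounded amount. Finally, cut a curve from a p to b p into about
  d(a p, b p) pieces of length at most 1 and replace each division point by a nearby point of the
  orbit of p: consecutive orbit points differ by one of finitely many group elements.
\<close>

section \<open>Riemannian distances are length distances\<close>

lemma C1_curve_on_subset:
  assumes c: "C1_curve_on A c I" and JI: "J \<subseteq> I"
  shows "C1_curve_on A c J"
  unfolding C1_curve_on_def
proof (intro conjI ballI)
  show "continuous_on J c"
    using c JI continuous_on_subset unfolding C1_curve_on_def by blast
  fix \<kappa> assume "\<kappa> \<in> A"
  then obtain U \<phi> where \<kappa>: "\<kappa> = (U, \<phi>)" "(U, \<phi>) \<in> A"
    by (cases \<kappa>) auto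
  then obtain v where v: "continuous_on (I \<inter> c -` U) v"
    "\<And>t. t \<in> I \<inter> c -` U \<Longrightarrow> (\<phi> \<circ> c has_vector_derivative v t) (at t within I)"
    using c unfolding C1_curve_on_def by blast
  have "continuous_on (J \<inter> c -` U) v"
    using v(1) JI by (auto intro: continuous_on_subset)
  moreover have "(\<phi> \<circ> c has_vector_derivative v t) (at t within J)" if "t \<in> J \<inter> c -` U" for t
    using v(2)[of t] that JI has_vector_derivative_within_subset by blast
  ultimately show "case \<kappa> of (U, \<phi>) \<Rightarrow> \<exists>v. continuous_on (J \<inter> c -` U) v \<and>
      (\<forall>t\<in>J \<inter> c -` U. (\<phi> \<circ> c has_vector_derivative v t) (at t within J))"
    using \<kappa> by auto
qed

text \<open>Add \<open>s\<close> and \<open>t\<close> to the part of the partition inside the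
  subinterval: each gap of the new partition lies in a gap of the old one, where the curve is C1.
  This is what allows curves to be cut.\<close>

lemma piecewise_C1_curve_subinterval:
  assumes c: "piecewise_C1_curve A c a b" and st: "a \<le> s" "s \<le> t" "t \<le> b"
  shows "piecewise_C1_curve A c s t"
proof -
  obtain P where P: "finite P" "{a, b} \<subseteq> P" "P \<subseteq> {a..b}"
    and C1: "\<And>s t. s \<in> P \<Longrightarrow> t \<in> P \<Longrightarrow> s < t \<Longrightarrow> {s<..<t} \<inter> P = {} \<Longrightarrow> C1_curve_on A c {s..t}"
    using c unfolding piecewise_C1_curve_def by metis
  define Q where "Q = (P \<inter> {s..t}) \<union> {s, t}"
  have "C1_curve_on A c {u..v}"
    if uv: "u \<in> Q" "v \<in> Q" "u < v" "{u<..<v} \<inter> Q = {}" for u v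
  proof -
    have suv: "s \<le> u" "v \<le> t"
      using uv st by (auto simp: Q_def)
    \<comment> \<open>The points of \<open>P\<close> nearest to the gap from outside. They exist
      because \<open>a\<close> and \<open>b\<close> belong to \<open>P\<close>; any point of
      \<open>P\<close> strictly between them would lie in the gap of \<open>Q\<close>.\<close>
    define u' where "u' = Max {p \<in> P. p \<le> u}"
    define v' where "v' = Min {p \<in> P. v \<le> p}"
    have u': "u' \<in> {p \<in> P. p \<le> u}"
      unfolding u'_def using P st suv by (intro Max_in) auto
    have v': "v' \<in> {p \<in> P. v \<le> p}"
      unfolding v'_def using P st suv by (intro Min_in) auto
    have "p \<notin> P" if "u' < p" "p < v'" for p
    proof
      assume "p \<in> P"
      have "p \<le> u'" if "p \<le> u"
        unfolding u'_def using that \<open>p \<in> P\<close> P(1) by (intro Max_ge) auto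
      moreover have "v' \<le> p" if "v \<le> p"
        unfolding v'_def using that \<open>p \<in> P\<close> P(1) by (intro Min_le) auto
      ultimately have "\<not> p \<le> u" "\<not> v \<le> p"
        using that by auto
      then have "p \<in> {u<..<v}"
        by simp
      moreover from this have "p \<in> Q"
        using \<open>p \<in> P\<close> suv by (auto simp: Q_def)
      ultimately show False
        using uv(4) by blast
    qed
    then have "C1_curve_on A c {u'..v'}"
      using u' v' uv(3) by (intro C1) auto
    then show ?thesis
      by (rule C1_curve_on_subset) (use u' v' in auto)
  qed
  moreover have "continuous_on {s..t} c"
    using c st unfolding piecewise_C1_curve_def by (auto intro: continuous_on_subset)
  moreover have "finite Q" "{s, t} \<subseteq> Q" "Q \<subseteq> {s..t}"
    using P(1) st by (auto simp: Q_def)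
  ultimately show ?thesis
    unfolding piecewise_C1_curve_def using st(2) by blast
qed

context riemannian_metric_space
begin

lemma dist_le_curve_length:
  assumes "L \<in> curve_lengths A g x y"
  shows "dist x y \<le> L"
proof -
  have "ereal (dist x y) \<le> ereal L"
    unfolding riemannian_distance using assms by (rule INF_lower)
  then show ?thesis by simp
qed

text \<open>The arc over \<open>{s..t}\<close> is itself admissible in the infimum defining the
  distance. Its length is written as a difference of values of one primitive so that
  \<open>chain_between\<close> can apply the intermediate value theorem to that primitive.\<close>

lemma dist_le_integral_speed:
  assumes "piecewise_C1_curve A c a b" "speed A g c integrable_on {a..b}"
    and "a \<le> s" "s \<le> t" "t \<le> b"
  shows "dist (c s) (c t) \<le> integral {a..t} (speed A g c) - integral {a..s} (speed A g c)"
proof -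
  have "speed A g c integrable_on {s..t}" "speed A g c integrable_on {a..t}"
    using assms(3-5) integrable_on_subinterval[OF assms(2)] by auto
  moreover have "piecewise_C1_curve A c s t"
    using assms piecewise_C1_curve_subinterval by blast
  ultimately have "dist (c s) (c t) \<le> integral {s..t} (speed A g c)"
    unfolding curve_lengths_def using integrable_integral
    by (intro dist_le_curve_length) (auto simp: curve_lengths_def)
  also have "\<dots> = integral {a..t} (speed A g c) - integral {a..s} (speed A g c)"
    using Henstock_Kurzweil_Integration.integral_combine[of a s t "speed A g c"] assms
      \<open>speed A g c integrable_on {a..t}\<close> by simp
  finally show ?thesis .
qed

text \<open>The infimum need not be attained, hence the strict bound: some curve has length
  \<open>L < l\<close>. Its arc length is continuous in the parameter, so it takes each value
  \<open>i * L / n\<close>, and the points of the curve at these parameters form the chain.\<close>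

lemma chain_between:
  fixes x y :: 'x
  assumes l: "dist x y < l" and n: "0 < n"
  obtains f where "f 0 = x" "f n = y" "\<And>i. i < n \<Longrightarrow> dist (f i) (f (Suc i)) \<le> l / real n"
proof -
  have "(INF L\<in>curve_lengths A g x y. ereal L) < ereal l"
    using l by (simp flip: riemannian_distance)
  then obtain L where L: "L \<in> curve_lengths A g x y" "L < l"
    by (auto simp: INF_less_iff)
  then obtain c a b where c: "piecewise_C1_curve A c a b" "c a = x" "c b = y"
    and sp: "(speed A g c has_integral L) {a..b}"
    unfolding curve_lengths_def by blast
  have "a \<le> b" using c(1) unfolding piecewise_C1_curve_def by blast
  have L0: "0 \<le> L"
    using dist_le_curve_length[OF L(1)] zero_le_dist[of x y] by linarith
  define F where "F t = integral {a..t} (speed A g c)" for t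
  have F: "F a = 0" "F b = L"
    using sp by (auto simp: F_def)
  have int: "speed A g c integrable_on {a..b}"
    using sp by blast
  have cont: "continuous_on {a..b} F"
    unfolding F_def using int by (rule indefinite_integral_continuous_1)
  \<comment> \<open>The absolute value makes the order of \<open>s\<close> and \<open>t\<close>
    irrelevant, so the division parameters chosen below need not be shown to increase.\<close>
  have distF: "dist (c s) (c t) \<le> \<bar>F t - F s\<bar>" if "s \<in> {a..b}" "t \<in> {a..b}" for s t
  proof (cases "s \<le> t")
    case True
    then show ?thesis
      using dist_le_integral_speed[OF c(1) int, of s t] that by (auto simp: F_def)
  next
    case False
    then show ?thesis
      using dist_le_integral_speed[OF c(1) int, of t s] that by (auto simp: F_def dist_commute)
  qed
  \<comment> \<open>The end parameters are prescribed rather than taken from the intermediate value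
    theorem, so that the chain starts at \<open>x\<close> and ends at \<open>y\<close>.\<close>
  have "\<exists>t. i \<le> n \<longrightarrow> t \<in> {a..b} \<and> F t = real i * L / real n \<and> (i = 0 \<longrightarrow> t = a) \<and> (i = n \<longrightarrow> t = b)"
    for i
  proof -
    consider "i = 0" | "i = n" | "0 < i" "i < n" | "n < i" by linarith
    then show ?thesis
    proof cases
      case 3
      then have "real i * L / real n \<le> L"
        using L0 by (simp add: divide_le_eq mult.commute mult_left_mono)
      then have "\<exists>t\<ge>a. t \<le> b \<and> F t = real i * L / real n"
        using F L0 \<open>a \<le> b\<close> cont by (intro IVT') auto
      then show ?thesis using 3 by auto
    qed (use n F \<open>a \<le> b\<close> in auto)
  qed
  then obtain t where t: "\<And>i. i \<le> n \<Longrightarrow> t i \<in> {a..b} \<and> F (t i) = real i * L / real n"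
    and t0: "t 0 = a" and tn: "t n = b"
    by (metis le0 le_refl)
  show thesis
  proof (rule that[of "c \<circ> t"])
    show "(c \<circ> t) 0 = x" "(c \<circ> t) n = y"
      using t0 tn c by auto
    fix i assume "i < n"
    then have "dist (c (t i)) (c (t (Suc i))) \<le> \<bar>F (t (Suc i)) - F (t i)\<bar>"
      using t by (intro distF) auto
    also have "F (t (Suc i)) - F (t i) = L / real n"
      using t[of i] t[of "Suc i"] \<open>i < n\<close> by (simp add: field_simps)
    also have "\<bar>L / real n\<bar> \<le> l / real n"
      using L0 L(2) by (simp add: divide_right_mono)
    finally show "dist ((c \<circ> t) i) ((c \<circ> t) (Suc i)) \<le> l / real n"
      by simp
  qed
qed

end

section \<open>Compactness of closed balls\<close>

text \<open>Local compactness, transported from the model space: a compact neighbourhood of the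
  coordinate point is carried back by the inverse chart, and a small metric ball lies inside the
  result.\<close>

lemma smooth_manifold_ex_compact_cball:
  fixes V :: "'e::euclidean_space set" and A :: "('x::metric_space, 'e) chart set" and x :: 'x
  assumes "smooth_manifold V A"
  obtains r where "0 < r" "compact (cball x r)"
proof -
  interpret smooth_manifold V A by fact
  obtain U \<phi> where U: "(U, \<phi>) \<in> A" "x \<in> U"
  proof -
    have "x \<in> (\<Union>(U, \<phi>)\<in>A. U)"
      by (simp add: charts_cover)
    then show thesis
      using that by auto
  qed
  define \<psi> where "\<psi> = inv_into U \<phi>"
  have homeo: "homeomorphism U (\<phi> ` U) \<phi> \<psi>"
    unfolding \<psi>_def by (rule chart_homeomorphism[OF U(1)])
  obtain e where e: "0 < e" "cball (\<phi> x) e \<inter> V \<subseteq> \<phi> ` U"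
    using chart_image[OF U(1)] U(2) unfolding openin_contains_cball by blast
  define K where "K = \<psi> ` (cball (\<phi> x) e \<inter> V)"
  \<comment> \<open>A linear subspace of a Euclidean space is closed.\<close>
  have "compact (cball (\<phi> x) e \<inter> V)"
    using closed_subspace[OF subspace_model] by (simp add: compact_Int_closed)
  then have K: "compact K"
    unfolding K_def using homeo e(2)
    by (intro compact_continuous_image) (auto simp: homeomorphism_def intro: continuous_on_subset)
  have "open (U \<inter> \<phi> -` ball (\<phi> x) e)"
    using homeo chart_domain[OF U(1)] by (intro continuous_open_preimage) (auto simp: homeomorphism_def)
  then obtain r where r: "0 < r" "cball x r \<subseteq> U \<inter> \<phi> -` ball (\<phi> x) e"
    using U(2) e(1) by (metis IntI centre_in_ball open_contains_cball vimageI2)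
  have "y \<in> K" if "y \<in> U \<inter> \<phi> -` ball (\<phi> x) e" for y
  proof -
    have "\<phi> y \<in> V"
      using that chart_image[OF U(1)] by (auto simp: openin_euclidean_subtopology_iff)
    moreover have "y = \<psi> (\<phi> y)"
      using that homeo by (auto simp: homeomorphism_def)
    ultimately show ?thesis
      using that unfolding K_def by auto
  qed
  with r have "cball x r = K \<inter> cball x r" by blast
  also have "compact \<dots>"
    using K by (intro compact_Int_closed) auto
  finally show thesis
    using r(1) that by blast
qed

text \<open>Finitely many balls of radius \<open>r / 2\<close> cover \<open>K\<close>; doubling
  their radius covers everything within \<open>r / 2\<close> of \<open>K\<close>, and the doubled
  closed balls are compact.\<close>

lemma compact_thickening:
  fixes K :: "'a::metric_space set"
  assumes "compact K" and r: "0 < r" and cb: "\<And>x::'a. compact (cball x r)"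
  obtains K' where "compact K'" "\<And>x y. x \<in> K \<Longrightarrow> dist x y \<le> r / 2 \<Longrightarrow> y \<in> K'"
proof -
  have "K \<subseteq> (\<Union>x\<in>K. ball x (r / 2))"
    using r by auto
  then obtain C where C: "C \<subseteq> K" "finite C" "K \<subseteq> (\<Union>x\<in>C. ball x (r / 2))"
    using compactE_image[OF \<open>compact K\<close>, of K "\<lambda>x. ball x (r / 2)"] by auto
  show thesis
  proof
    show "compact (\<Union>x\<in>C. cball x r)"
      using C(2) cb by (intro compact_UN) auto
    fix x y assume "x \<in> K" and xy: "dist x y \<le> r / 2"
    then obtain z where "z \<in> C" "dist z x < r / 2"
      using C(3) by auto
    then show "y \<in> (\<Union>x\<in>C. cball x r)"
      using xy dist_triangle[of z y x] by force
  qed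
qed

text \<open>A Hopf-Rinow argument without geodesics: homogeneity gives one radius \<open>r\<close>
  for which all closed balls are compact, and chains with steps of at most \<open>r / 2\<close>
  extend compactness to any radius.\<close>

lemma (in symmetric_space) compact_cball:
  fixes x :: 'x
  shows "compact (cball x R)"
proof -
  obtain r where r: "0 < r" "compact (cball x r)"
    using smooth_manifold_ex_compact_cball smooth_manifold_axioms by blast
  have cb: "compact (cball y r)" for y :: 'x
  proof -
    obtain h where h: "h \<in> carrier G" "act h x = y"
      using unique_orbit by (metis UNIV_I)
    have surj: "surj (act h)"
      using surj_prop[OF h(1)] .
    have "cball y r = act h ` cball x r"
    proof (intro equalityI subsetI)
      fix z assume z: "z \<in> cball y r"
      obtain w where "z = act h w" using surj by blast
      then show "z \<in> act h ` cball x r"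
        using z acts_by_isometries[OF h(1)] h(2) by auto
    qed (use acts_by_isometries[OF h(1)] h(2) in auto)
    moreover have "continuous_on (cball x r) (act h)"
      using acts_by_isometries[OF h(1)] by (auto simp: continuous_on_iff)
    ultimately show ?thesis
      using r(2) compact_continuous_image by metis
  qed
  \<comment> \<open>The points reachable from \<open>x\<close> in \<open>n\<close> steps of size at
    most \<open>r / 2\<close> lie in a compact set; each step is one thickening.\<close>
  have reach: "\<exists>K. compact K \<and> (\<forall>f. f 0 = x \<longrightarrow> (\<forall>i<n. dist (f i) (f (Suc i)) \<le> r / 2) \<longrightarrow> f n \<in> K)" for n
  proof (induction n)
    case 0
    show ?case by (intro exI[of _ "{x}"]) auto
  next
    case (Suc n)
    then obtain K where K: "compact K"
      "\<And>f. f 0 = x \<Longrightarrow> \<forall>i<n. dist (f i) (f (Suc i)) \<le> r / 2 \<Longrightarrow> f n \<in> K"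
      by blast
    obtain K' where K': "compact K'" "\<And>x y. x \<in> K \<Longrightarrow> dist x y \<le> r / 2 \<Longrightarrow> y \<in> K'"
      using compact_thickening[OF K(1) r(1) cb] by blast
    have "f (Suc n) \<in> K'" if "f 0 = x" "\<forall>i<Suc n. dist (f i) (f (Suc i)) \<le> r / 2" for f
      using that K(2)[of f] K'(2)[of "f n"] by simp
    with K'(1) show ?case by blast
  qed
  \<comment> \<open>\<open>\<bar>R\<bar> + 1\<close> is positive for every \<open>R\<close> and
    strictly exceeds the distance from \<open>x\<close> to any point of the ball, as
    \<open>chain_between\<close> requires. One \<open>n\<close> serves the whole ball.\<close>
  obtain n where n: "2 * (\<bar>R\<bar> + 1) / r < real n"
    using reals_Archimedean2 by blast
  have "0 < 2 * (\<bar>R\<bar> + 1) / r"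
    using r(1) by (simp add: add_nonneg_pos)
  with n have n0: "0 < n"
    by (metis of_nat_0_less_iff order.strict_trans)
  have step: "(\<bar>R\<bar> + 1) / real n \<le> r / 2"
    using n n0 r(1) by (simp add: field_simps)
  obtain K where K: "compact K"
    "\<And>f. f 0 = x \<Longrightarrow> \<forall>i<n. dist (f i) (f (Suc i)) \<le> r / 2 \<Longrightarrow> f n \<in> K"
    using reach[of n] by blast
  have "y \<in> K" if y: "y \<in> cball x R" for y :: 'x
  proof -
    have "dist x y < \<bar>R\<bar> + 1" using y by auto
    then obtain f where "f 0 = x" "f n = y" "\<And>i. i < n \<Longrightarrow> dist (f i) (f (Suc i)) \<le> (\<bar>R\<bar> + 1) / real n"
      using chain_between[OF _ n0] by blast
    then show ?thesis
      using K(2)[of f] step order_trans by blast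
  qed
  then have "cball x R = K \<inter> cball x R" by blast
  also have "compact \<dots>"
    using K(1) by (intro compact_Int_closed) auto
  finally show ?thesis .
qed

section \<open>Isometry groups and their orbits\<close>

lemma group_isometry_group: "group (isometry_group :: ('x::metric_space \<Rightarrow> 'x) monoid)"
proof (rule groupI)
  fix f :: "'x \<Rightarrow> 'x" assume f: "f \<in> carrier isometry_group"
  then have "bij f" and iso: "\<And>x y. dist (f x) (f y) = dist x y"
    by (simp_all add: isometry_group_def)
  have "dist (inv_into UNIV f x) (inv_into UNIV f y) = dist x y" for x y
    using iso[of "inv_into UNIV f x" "inv_into UNIV f y"] \<open>bij f\<close> by (simp add: bij_is_surj surj_f_inv_f)
  then have "inv_into UNIV f \<in> carrier isometry_group"
    using \<open>bij f\<close> by (simp add: isometry_group_def bij_imp_bij_inv)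
  moreover have "inv_into UNIV f \<circ> f = id"
    using \<open>bij f\<close> by (simp add: bij_is_inj)
  ultimately show "\<exists>h\<in>carrier isometry_group. h \<otimes>\<^bsub>isometry_group\<^esub> f = \<one>\<^bsub>isometry_group\<^esub>"
    by (auto simp: isometry_group_def)
qed (auto simp: isometry_group_def bij_comp o_assoc)

text \<open>Since the tiles are disjoint and contain congruent balls, the images of a point
  \<open>x\<close> of \<open>D\<close> are uniformly separated. Those coming from elements of
  bounded displacement lie in one compact ball, so there are finitely many.\<close>

lemma finite_small_displacement:
  fixes \<Gamma> :: "('x::metric_space \<Rightarrow> 'x) set"
  assumes iso: "\<Gamma> \<subseteq> carrier isometry_group"
    and D: "open D" "D \<noteq> {}" "disjoint_family_on (\<lambda>\<gamma>. \<gamma> ` D) \<Gamma>"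
    and cb: "\<And>(x::'x) r. compact (cball x r)"
  shows "finite {\<gamma>\<in>\<Gamma>. dist p (\<gamma> p) \<le> R}"
proof -
  obtain x r where r: "0 < r" "ball x r \<subseteq> D"
    using D(1,2) open_contains_ball by blast
  then have x: "x \<in> D" by auto
  define F where "F = {\<gamma>\<in>\<Gamma>. dist p (\<gamma> p) \<le> R}"
  \<comment> \<open>If the two images are closer than \<open>r\<close>, pulling \<gamma>' x back by
    \<gamma> gives a point of the ball around \<open>x\<close>, hence of \<open>D\<close>; then
    \<gamma>' x lies in both tiles.\<close>
  have sep: "\<gamma> = \<gamma>'" if \<gamma>: "\<gamma> \<in> \<Gamma>" "\<gamma>' \<in> \<Gamma>" and less: "dist (\<gamma> x) (\<gamma>' x) < r" for \<gamma> \<gamma>'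
  proof (rule ccontr)
    assume "\<gamma> \<noteq> \<gamma>'"
    have "surj \<gamma>" "\<And>y z. dist (\<gamma> y) (\<gamma> z) = dist y z"
      using \<gamma>(1) iso by (auto simp: isometry_group_def bij_def)
    then obtain y where y: "\<gamma>' x = \<gamma> y" "dist x y < r"
      using less by (metis surjD)
    then have "y \<in> D"
      using r(2) by auto
    with x y(1) have "\<gamma>' x \<in> \<gamma> ` D \<inter> \<gamma>' ` D"
      by blast
    with \<open>\<gamma> \<noteq> \<gamma>'\<close> show False
      using disjoint_family_onD[OF D(3) \<gamma>] by blast
  qed
  have "inj_on (\<lambda>\<gamma>. \<gamma> x) F"
    using sep r(1) by (auto simp: inj_on_def F_def)
  moreover have "finite ((\<lambda>\<gamma>. \<gamma> x) ` F)"
  proof (rule ccontr)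
    assume inf: "infinite ((\<lambda>\<gamma>. \<gamma> x) ` F)"
    \<comment> \<open>Go from \<open>x\<close> to \<gamma> x through \<open>p\<close> and \<gamma>
      p; the first and last legs both have length \<open>dist p x\<close>.\<close>
    have "dist x (\<gamma> x) \<le> R + 2 * dist p x" if "\<gamma> \<in> F" for \<gamma>
    proof -
      have "dist (\<gamma> p) (\<gamma> x) = dist p x" "dist p (\<gamma> p) \<le> R"
        using that iso by (auto simp: F_def isometry_group_def)
      then show ?thesis
        using dist_triangle[of x "\<gamma> x" p] dist_triangle[of p "\<gamma> x" "\<gamma> p"] by (simp add: dist_commute)
    qed
    then have "(\<lambda>\<gamma>. \<gamma> x) ` F \<subseteq> cball x (R + 2 * dist p x)"
      by auto
    then obtain z where "z islimpt (\<lambda>\<gamma>. \<gamma> x) ` F"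
      using Heine_Borel_imp_Bolzano_Weierstrass[OF cb inf] by blast
    moreover have "\<forall>u\<in>(\<lambda>\<gamma>. \<gamma> x) ` F. \<forall>v\<in>(\<lambda>\<gamma>. \<gamma> x) ` F. dist v u < r \<longrightarrow> v = u"
      using sep by (auto simp: F_def)
    \<comment> \<open>A uniformly separated set has no limit point, against Bolzano-Weierstrass in
      the compact ball.\<close>
    ultimately show False
      using discrete_imp_not_islimpt[OF r(1), of "(\<lambda>\<gamma>. \<gamma> x) ` F" z] by blast
  qed
  ultimately show ?thesis
    unfolding F_def[symmetric] by (rule finite_imageD[rotated])
qed

section \<open>Word distances\<close>

context group
begin

lemma mult_inv_mult: "\<lbrakk>x \<in> carrier G; y \<in> carrier G\<rbrakk> \<Longrightarrow> x \<otimes> (inv x \<otimes> y) = y"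
  by (simp flip: m_assoc)

lemma foldr_mult_append:
  assumes "set us \<subseteq> carrier G" "set vs \<subseteq> carrier G"
  shows "foldr (\<lambda>s t. s \<otimes> t) (us @ vs) \<one> = foldr (\<lambda>s t. s \<otimes> t) us \<one> \<otimes> foldr (\<lambda>s t. s \<otimes> t) vs \<one>"
proof -
  have closed: "foldr (\<lambda>s t. s \<otimes> t) ws \<one> \<in> carrier G" if "set ws \<subseteq> carrier G" for ws
    using that by (induction ws) auto
  show ?thesis
    using assms(1)
  proof (induction us)
    case Nil
    then show ?case using closed[OF assms(2)] by simp
  next
    case (Cons u us)
    then show ?case
      using closed[OF assms(2)] closed[of us] by (simp add: m_assoc)
  qed
qed

lemma generate_imp_word:
  assumes S: "S \<subseteq> carrier G" and x: "x \<in> generate G S"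
  shows "\<exists>ws. set ws \<subseteq> S \<union> (\<lambda>s. inv s) ` S \<and> x = foldr (\<lambda>s t. s \<otimes> t) ws \<one>"
  using x
proof induction
  case one
  show ?case by (intro exI[of _ "[]"]) auto
next
  case (incl h)
  then show ?case using S by (intro exI[of _ "[h]"]) auto
next
  case (inv h)
  then show ?case using S by (intro exI[of _ "[inv h]"]) auto
next
  case (eng x y)
  then obtain us vs where "set us \<subseteq> S \<union> (\<lambda>s. inv s) ` S" "x = foldr (\<lambda>s t. s \<otimes> t) us \<one>"
    and "set vs \<subseteq> S \<union> (\<lambda>s. inv s) ` S" "y = foldr (\<lambda>s t. s \<otimes> t) vs \<one>"
    by blast
  moreover from this have "set us \<subseteq> carrier G" "set vs \<subseteq> carrier G"
    using S by auto
  ultimately show ?case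
    using foldr_mult_append[of us vs] by (intro exI[of _ "us @ vs"]) auto
qed

lemma word_dist_le:
  assumes "set ws \<subseteq> S \<union> (\<lambda>s. inv s) ` S" "inv a \<otimes> b = foldr (\<lambda>s t. s \<otimes> t) ws \<one>"
  shows "word_dist G S a b \<le> length ws"
  unfolding word_dist_def using assms by (intro Least_le) blast

text \<open>Generation guarantees that some word exists, so the \<open>LEAST\<close> in the
  definition is a genuine minimum.\<close>

lemma word_dist_attained:
  assumes S: "S \<subseteq> carrier G" and ab: "a \<in> generate G S" "b \<in> generate G S"
  obtains ws where "length ws = word_dist G S a b" "set ws \<subseteq> S \<union> (\<lambda>s. inv s) ` S"
    "inv a \<otimes> b = foldr (\<lambda>s t. s \<otimes> t) ws \<one>"
proof -
  have "inv a \<otimes> b \<in> generate G S"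
    using generate_is_subgroup[OF S] ab by (simp add: subgroup.m_inv_closed subgroup.m_closed)
  then have "\<exists>n ws. length ws = n \<and> set ws \<subseteq> S \<union> (\<lambda>s. inv s) ` S \<and>
      inv a \<otimes> b = foldr (\<lambda>s t. s \<otimes> t) ws \<one>"
    using generate_imp_word[OF S] by blast
  then have "\<exists>ws. length ws = word_dist G S a b \<and> set ws \<subseteq> S \<union> (\<lambda>s. inv s) ` S \<and>
      inv a \<otimes> b = foldr (\<lambda>s t. s \<otimes> t) ws \<one>"
    unfolding word_dist_def by (rule LeastI_ex)
  then show thesis using that by blast
qed

lemma word_dist_refl:
  assumes "a \<in> carrier G"
  shows "word_dist G S a a = 0"
  using word_dist_le[of "[]" S a a] assms by simp

lemma word_dist_triangle:
  assumes S: "S \<subseteq> carrier G" and abc: "a \<in> generate G S" "b \<in> generate G S" "c \<in> generate G S"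
  shows "word_dist G S a c \<le> word_dist G S a b + word_dist G S b c"
proof -
  obtain us where us: "length us = word_dist G S a b" "set us \<subseteq> S \<union> (\<lambda>s. inv s) ` S"
    "inv a \<otimes> b = foldr (\<lambda>s t. s \<otimes> t) us \<one>"
    using word_dist_attained[OF S abc(1,2)] by blast
  obtain vs where vs: "length vs = word_dist G S b c" "set vs \<subseteq> S \<union> (\<lambda>s. inv s) ` S"
    "inv b \<otimes> c = foldr (\<lambda>s t. s \<otimes> t) vs \<one>"
    using word_dist_attained[OF S abc(2,3)] by blast
  have "a \<in> carrier G" "b \<in> carrier G" "c \<in> carrier G"
    using abc generate_incl[OF S] by auto
  then have "inv a \<otimes> c = (inv a \<otimes> b) \<otimes> (inv b \<otimes> c)"
    by (simp add: m_assoc mult_inv_mult)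
  moreover have "S \<union> (\<lambda>s. inv s) ` S \<subseteq> carrier G"
    using S by auto
  then have "set us \<subseteq> carrier G" "set vs \<subseteq> carrier G"
    using us(2) vs(2) by blast+
  ultimately have "inv a \<otimes> c = foldr (\<lambda>s t. s \<otimes> t) (us @ vs) \<one>"
    using us(3) vs(3) foldr_mult_append[of us vs] by simp
  then have "word_dist G S a c \<le> length (us @ vs)"
    using us(2) vs(2) by (intro word_dist_le) auto
  then show ?thesis using us(1) vs(1) by simp
qed

lemma word_dist_chain:
  assumes S: "S \<subseteq> carrier G" and h: "\<And>i. i \<le> n \<Longrightarrow> h i \<in> generate G S"
    and N: "\<And>i. i < n \<Longrightarrow> word_dist G S (h i) (h (Suc i)) \<le> N"
  shows "word_dist G S (h 0) (h n) \<le> n * N"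
  using h N
proof (induction n)
  case 0
  then show ?case
    using generate_in_carrier[OF S] word_dist_refl by simp
next
  case (Suc n)
  then have "word_dist G S (h 0) (h n) \<le> n * N" "word_dist G S (h n) (h (Suc n)) \<le> N"
    by simp_all
  then show ?case
    using word_dist_triangle[OF S, of "h 0" "h n" "h (Suc n)"] Suc.prems(1) by fastforce
qed

end

text \<open>Peel off the first letter \<open>s\<close>: the remaining word moves \<open>p\<close> to
  \<open>w p\<close>, and \<open>s\<close> preserves the distance between these points, so the
  letter adds at most \<open>M\<close> by the triangle inequality through
  \<open>s p\<close>.\<close>

lemma dist_foldr_isometries:
  fixes p :: "'x::metric_space"
  assumes "set ws \<subseteq> carrier isometry_group" "\<And>s. s \<in> set ws \<Longrightarrow> dist p (s p) \<le> M"
  shows "dist p (foldr (\<lambda>s t. s \<otimes>\<^bsub>isometry_group\<^esub> t) ws \<one>\<^bsub>isometry_group\<^esub> p) \<le> real (length ws) * M"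
  using assms
proof (induction ws)
  case Nil
  show ?case by (simp add: isometry_group_def)
next
  case (Cons s ws)
  define w where "w = foldr (\<lambda>s t. s \<otimes>\<^bsub>isometry_group\<^esub> t) ws \<one>\<^bsub>isometry_group\<^esub>"
  have "dist p (w p) \<le> real (length ws) * M"
    unfolding w_def using Cons by simp
  moreover have "dist (s p) (s (w p)) = dist p (w p)" "dist p (s p) \<le> M"
    using Cons.prems by (auto simp: isometry_group_def)
  moreover have "foldr (\<lambda>s t. s \<otimes>\<^bsub>isometry_group\<^esub> t) (s # ws) \<one>\<^bsub>isometry_group\<^esub> p = s (w p)"
    by (simp add: w_def isometry_group_def)
  ultimately show ?case
    using dist_triangle[of p "s (w p)" "s p"] by (simp add: algebra_simps)
qed

section \<open>Comparison of the two distances\<close>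

text \<open>The prescribed \<open>m\<close> below the bound covers an empty \<open>F\<close> and
  lets the bound be chosen nonnegative.\<close>

lemma ex_bound_on_finite:
  fixes f :: "'a \<Rightarrow> 'b::linorder"
  assumes "finite F"
  obtains M where "m \<le> M" "\<And>x. x \<in> F \<Longrightarrow> f x \<le> M"
  using assms Max_ge[of "insert m (f ` F)"] by (metis finite.insertI finite_imageI image_eqI insertI1 insertI2)

theorem theorem3p4p1:
  fixes V :: "'e::euclidean_space set"
    and A :: "('x::metric_space, 'e) chart set"
    and g :: "('x, 'e) chart \<Rightarrow> 'x \<Rightarrow> 'e \<Rightarrow> 'e \<Rightarrow> real"
    and G :: "('g, 'm) monoid_scheme"
    and act :: "'g \<Rightarrow> 'x \<Rightarrow> 'x"
    and \<Gamma> :: "('x \<Rightarrow> 'x) set"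
    and D :: "'x set"
    and p\<^sub>0 :: 'x
    and \<Sigma> :: "('x \<Rightarrow> 'x) set"
  assumes "symmetric_space V A g G act"
    and "discrete_isometry_group \<Gamma>"
    and "fundamental_domain \<Gamma> D"
    and "compact (closure D)"
    and "{\<gamma>\<in>\<Gamma>. \<gamma> p\<^sub>0 = p\<^sub>0} = {id}"
    and "finite \<Sigma>"
    and "\<Sigma> \<subseteq> \<Gamma>"
    and "generate isometry_group \<Sigma> = \<Gamma>"
  shows "lipschitz_equivalent_on \<Gamma> (geometric_dist p\<^sub>0)
           (\<lambda>\<gamma>\<^sub>1 \<gamma>\<^sub>2. real (word_dist isometry_group \<Sigma> \<gamma>\<^sub>1 \<gamma>\<^sub>2))"
proof -
  interpret symmetric_space V A g G act by fact
  let ?I = "isometry_group :: ('x \<Rightarrow> 'x) monoid"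
  interpret I: group ?I by (rule group_isometry_group)
  have sub: "subgroup \<Gamma> ?I"
    using assms(2) unfolding discrete_isometry_group_def by blast
  have \<Gamma>: "\<Gamma> \<subseteq> carrier ?I"
    using sub by (rule subgroup.subset)
  have \<Sigma>: "\<Sigma> \<subseteq> carrier ?I"
    using assms(7) \<Gamma> by blast
  have iso: "dist (\<gamma> x) (\<gamma> y) = dist x y" if "\<gamma> \<in> \<Gamma>" for \<gamma> x y
    using that \<Gamma> by (auto simp: isometry_group_def)
  have quot: "inv\<^bsub>?I\<^esub> a \<otimes>\<^bsub>?I\<^esub> b \<in> \<Gamma>" if "a \<in> \<Gamma>" "b \<in> \<Gamma>" for a b
    using sub that by (simp add: subgroup.m_inv_closed subgroup.m_closed)
  have mult_apply: "(f \<otimes>\<^bsub>?I\<^esub> h) x = f (h x)" for f h x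
    by (simp add: isometry_group_def)
  \<comment> \<open>Left invariance: all estimates reduce to the displacement of a point by the
    quotient of \<open>a\<close> and \<open>b\<close>.\<close>
  have dist_quot: "dist (a x) (b x) = dist x ((inv\<^bsub>?I\<^esub> a \<otimes>\<^bsub>?I\<^esub> b) x)"
    if "a \<in> \<Gamma>" "b \<in> \<Gamma>" for a b x
  proof -
    have "a \<otimes>\<^bsub>?I\<^esub> (inv\<^bsub>?I\<^esub> a \<otimes>\<^bsub>?I\<^esub> b) = b"
      using that \<Gamma> by (intro I.mult_inv_mult) auto
    then have "b x = a ((inv\<^bsub>?I\<^esub> a \<otimes>\<^bsub>?I\<^esub> b) x)"
      by (metis mult_apply)
    then show ?thesis
      using iso[OF that(1)] by simp
  qed
  have fd: "open D" "disjoint_family_on (\<lambda>\<gamma>. \<gamma> ` D) \<Gamma>" "(\<Union>\<gamma>\<in>\<Gamma>. \<gamma> ` closure D) = UNIV"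
    using assms(3) unfolding fundamental_domain_def by blast+
  \<comment> \<open>The translates of the closure cover the space, which has a point because types
    are inhabited.\<close>
  then have "D \<noteq> {}" by auto
  have fin: "finite {\<gamma>\<in>\<Gamma>. dist p\<^sub>0 (\<gamma> p\<^sub>0) \<le> R}" for R
    using \<Gamma> fd(1) \<open>D \<noteq> {}\<close> fd(2) compact_cball by (rule finite_small_displacement)

  \<comment> \<open>Coarse density of the orbit and an affine upper bound for the word
    distance\<close>
  have "\<exists>M. \<forall>y\<in>closure D. dist p\<^sub>0 y \<le> M"
    using compact_imp_bounded[OF assms(4)] bounded_any_center by blast
  then obtain M where M: "\<And>y. y \<in> closure D \<Longrightarrow> dist p\<^sub>0 y \<le> M"
    by blast
  have near: "\<exists>\<gamma>\<in>\<Gamma>. dist x (\<gamma> p\<^sub>0) \<le> M" for x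
  proof -
    have "x \<in> (\<Union>\<gamma>\<in>\<Gamma>. \<gamma> ` closure D)"
      by (simp add: fd(3))
    then obtain \<gamma> y where "\<gamma> \<in> \<Gamma>" "y \<in> closure D" "x = \<gamma> y"
      by blast
    then show ?thesis
      using M[of y] iso[of \<gamma> y p\<^sub>0] by (intro bexI[of _ \<gamma>]) (auto simp: dist_commute)
  qed
  then have M0: "0 \<le> M"
    using zero_le_dist order_trans by blast

  \<comment> \<open>The radius \<open>2 * M + 1\<close> allows for a chain step of length at most 1
    and an error of at most \<open>M\<close> when each of its two end points is moved to the
    orbit.\<close>
  obtain N where N: "\<And>\<gamma>. \<gamma> \<in> {\<gamma>\<in>\<Gamma>. dist p\<^sub>0 (\<gamma> p\<^sub>0) \<le> 2 * M + 1} \<Longrightarrow> word_dist ?I \<Sigma> \<one>\<^bsub>?I\<^esub> \<gamma> \<le> N"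
    using ex_bound_on_finite[OF fin] by blast
  have wd_near: "word_dist ?I \<Sigma> a b \<le> N"
    if "a \<in> \<Gamma>" "b \<in> \<Gamma>" "dist (a p\<^sub>0) (b p\<^sub>0) \<le> 2 * M + 1" for a b
  proof -
    have "inv\<^bsub>?I\<^esub> a \<otimes>\<^bsub>?I\<^esub> b \<in> carrier ?I"
      using quot that \<Gamma> by blast
    then have "word_dist ?I \<Sigma> a b = word_dist ?I \<Sigma> \<one>\<^bsub>?I\<^esub> (inv\<^bsub>?I\<^esub> a \<otimes>\<^bsub>?I\<^esub> b)"
      by (simp add: word_dist_def)
    then show ?thesis
      using N[of "inv\<^bsub>?I\<^esub> a \<otimes>\<^bsub>?I\<^esub> b"] quot dist_quot that by simp
  qed
  have wd_upper: "real (word_dist ?I \<Sigma> a b) \<le> (dist (a p\<^sub>0) (b p\<^sub>0) + 2) * real N"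
    if ab: "a \<in> \<Gamma>" "b \<in> \<Gamma>" for a b
  proof -
    \<comment> \<open>The extra 1 makes \<open>n\<close> strictly larger than the distance. Applying
      \<open>chain_between\<close> with \<open>l = n\<close> then gives steps of length at most
      \<open>n / n = 1\<close>.\<close>
    define n where "n = nat \<lceil>dist (a p\<^sub>0) (b p\<^sub>0)\<rceil> + 1"
    have n: "0 < n" "dist (a p\<^sub>0) (b p\<^sub>0) < real n" "real n \<le> dist (a p\<^sub>0) (b p\<^sub>0) + 2"
      using zero_le_dist[of "a p\<^sub>0" "b p\<^sub>0"] unfolding n_def by linarith+
    obtain f where f: "f 0 = a p\<^sub>0" "f n = b p\<^sub>0"
      and f_step: "\<And>i. i < n \<Longrightarrow> dist (f i) (f (Suc i)) \<le> real n / real n"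
      using chain_between[OF n(2,1)] by blast
    obtain k where k: "\<And>i. k i \<in> \<Gamma>" "\<And>i. dist (f i) (k i p\<^sub>0) \<le> M"
      using choice[of "\<lambda>i \<gamma>. \<gamma> \<in> \<Gamma> \<and> dist (f i) (\<gamma> p\<^sub>0) \<le> M"] near by blast
    \<comment> \<open>The ends of the chain are already orbit points, so \<open>a\<close> and
      \<open>b\<close> themselves are used there, with error \<open>0 \<le> M\<close>.\<close>
    define h where "h i = (if i = 0 then a else if i = n then b else k i)" for i
    have h: "h i \<in> \<Gamma>" "dist (f i) (h i p\<^sub>0) \<le> M" for i
      using k ab f M0 by (auto simp: h_def)
    have "word_dist ?I \<Sigma> (h i) (h (Suc i)) \<le> N" if "i < n" for i
    proof (rule wd_near)
      show "dist (h i p\<^sub>0) (h (Suc i) p\<^sub>0) \<le> 2 * M + 1"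
        using f_step[OF that] h(2)[of i] h(2)[of "Suc i"] n(1)
          dist_triangle[of "h i p\<^sub>0" "h (Suc i) p\<^sub>0" "f i"]
          dist_triangle[of "f i" "h (Suc i) p\<^sub>0" "f (Suc i)"]
        by (simp add: dist_commute)
    qed (fact h)+
    then have "word_dist ?I \<Sigma> (h 0) (h n) \<le> n * N"
      using \<Sigma> h(1) assms(8) by (intro I.word_dist_chain) auto
    moreover have "h 0 = a" "h n = b"
      using n(1) by (auto simp: h_def)
    ultimately have "real (word_dist ?I \<Sigma> a b) \<le> real n * real N"
      by (simp flip: of_nat_mult)
    also have "\<dots> \<le> (dist (a p\<^sub>0) (b p\<^sub>0) + 2) * real N"
      using n(3) by (intro mult_right_mono) auto
    finally show ?thesis .
  qed

  \<comment> \<open>Minimal displacement and removal of the additive constant\<close>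
  define E where "E = {\<gamma>\<in>\<Gamma>. dist p\<^sub>0 (\<gamma> p\<^sub>0) \<le> 1} - {id}"
  \<comment> \<open>A positive lower bound for the displacement of \<open>p\<^sub>0\<close> by
    nontrivial elements: the set \<open>E\<close> is finite and its elements do not fix
    \<open>p\<^sub>0\<close>. The inserted 1 covers the elements outside \<open>E\<close> and an
    empty \<open>E\<close>.\<close>
  define \<delta> where "\<delta> = Min (insert 1 ((\<lambda>\<gamma>. dist p\<^sub>0 (\<gamma> p\<^sub>0)) ` E))"
  have "finite E" using fin by (simp add: E_def)
  have "p\<^sub>0 \<noteq> \<gamma> p\<^sub>0" if "\<gamma> \<in> E" for \<gamma>
    using that assms(5) unfolding E_def by force
  then have \<delta>0: "0 < \<delta>"
    using \<open>finite E\<close> by (simp add: \<delta>_def)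
  have \<delta>: "\<delta> \<le> dist (a p\<^sub>0) (b p\<^sub>0)" if ab: "a \<in> \<Gamma>" "b \<in> \<Gamma>" "a \<noteq> b" for a b
  proof -
    let ?w = "inv\<^bsub>?I\<^esub> a \<otimes>\<^bsub>?I\<^esub> b"
    have "a \<in> carrier ?I" "b \<in> carrier ?I"
      using ab \<Gamma> by auto
    then have "?w \<noteq> \<one>\<^bsub>?I\<^esub>"
      using I.mult_inv_mult[of a b] ab(3) by auto
    then have "?w \<noteq> id" by (simp add: isometry_group_def)
    then have "?w \<in> E \<or> 1 \<le> dist p\<^sub>0 (?w p\<^sub>0)"
      using quot ab unfolding E_def by auto
    then have "\<delta> \<le> dist p\<^sub>0 (?w p\<^sub>0)"
      using \<open>finite E\<close> unfolding \<delta>_def by (auto simp: Min_le_iff)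
    then show ?thesis
      using dist_quot ab by simp
  qed

  \<comment> \<open>For distinct elements the distance is at least \<delta>, so the additive 2 in
    \<open>wd_upper\<close> is at most \<open>2 / \<delta>\<close> times the distance. The final 1
    keeps \<open>C\<close> positive when \<open>N = 0\<close>.\<close>
  define C where "C = (1 + 2 / \<delta>) * real N + 1"
  have C0: "0 < C"
    using \<delta>0 unfolding C_def by (intro add_nonneg_pos mult_nonneg_nonneg) auto
  have upper: "real (word_dist ?I \<Sigma> a b) \<le> C * dist (a p\<^sub>0) (b p\<^sub>0)" if ab: "a \<in> \<Gamma>" "b \<in> \<Gamma>" for a b
  proof (cases "a = b")
    case True
    then show ?thesis
      using I.word_dist_refl ab \<Gamma> by auto
  next
    case False
    have "2 \<le> 2 / \<delta> * dist (a p\<^sub>0) (b p\<^sub>0)"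
      using \<delta>[OF ab False] \<delta>0 by (simp add: field_simps)
    then have "(dist (a p\<^sub>0) (b p\<^sub>0) + 2) * real N \<le> ((1 + 2 / \<delta>) * dist (a p\<^sub>0) (b p\<^sub>0)) * real N"
      by (intro mult_right_mono) (auto simp: algebra_simps)
    also have "\<dots> \<le> C * dist (a p\<^sub>0) (b p\<^sub>0)"
      unfolding C_def by (simp add: algebra_simps)
    finally show ?thesis
      using wd_upper[OF ab] by linarith
  qed

  \<comment> \<open>Lower bound for the word distance\<close>
  let ?L = "\<Sigma> \<union> (\<lambda>s. inv\<^bsub>?I\<^esub> s) ` \<Sigma>"
  have "?L \<subseteq> carrier ?I" "finite ?L"
    using \<Sigma> assms(6) by auto
  then obtain m where m: "0 \<le> m" "\<And>s. s \<in> ?L \<Longrightarrow> dist p\<^sub>0 (s p\<^sub>0) \<le> m"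
    using ex_bound_on_finite[of ?L 0 "\<lambda>s. dist p\<^sub>0 (s p\<^sub>0)"] by blast
  \<comment> \<open>Each letter of a shortest word moves \<open>p\<^sub>0\<close> by at most
    \<open>m\<close>. Using \<open>m + 1\<close> avoids division by zero when
    \<open>m = 0\<close>.\<close>
  have lower: "1 / (m + 1) * dist (a p\<^sub>0) (b p\<^sub>0) \<le> real (word_dist ?I \<Sigma> a b)"
    if ab: "a \<in> \<Gamma>" "b \<in> \<Gamma>" for a b
  proof -
    obtain ws where ws: "length ws = word_dist ?I \<Sigma> a b" "set ws \<subseteq> ?L"
      "inv\<^bsub>?I\<^esub> a \<otimes>\<^bsub>?I\<^esub> b = foldr (\<lambda>s t. s \<otimes>\<^bsub>?I\<^esub> t) ws \<one>\<^bsub>?I\<^esub>"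
      using I.word_dist_attained[OF \<Sigma>, of a b] ab assms(8) by blast
    have "dist (a p\<^sub>0) (b p\<^sub>0) \<le> real (length ws) * m"
      unfolding dist_quot[OF ab] ws(3)
      using ws(2) m(2) \<open>?L \<subseteq> carrier ?I\<close> by (intro dist_foldr_isometries) auto
    also have "\<dots> \<le> real (word_dist ?I \<Sigma> a b) * (m + 1)"
      by (simp add: ws(1) algebra_simps)
    finally show ?thesis
      using m(1) by (simp add: field_simps)
  qed

  show ?thesis
    unfolding lipschitz_equivalent_on_def geometric_dist_def
    using C0 m(1) lower upper
    by (intro exI[of _ "1 / (m + 1)"] exI[of _ C] conjI ballI) auto
qed

end
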